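(* Let $\mathcal{G}=(\mathcal{V},\mathcal{E})$ be a connected undirected graph on $\mathcal{V}=\{1,\dots,N\}$, $N\ge 2$, with spectral radius $\rho$, and let $\lambda$ be the growth rate of the noisy max-consensus recursion $$x_i(t+1)=\max\Big(x_i(t),\ \max_{j\in\mathcal{N}_i}\big(x_j(t)+v_{ij}(t)\big)\Big),$$ where the noise samples $v_{ij}(t)$ are i.i.d. with zero mean. Suppose that the moment generating function $M(\gamma):=\mathbb{E}[e^{\gamma v_{ij}(t)}]$ exists (is finite) for $\gamma$ in a neighborhood of the origin. Then $$\lambda\ \le\ \inf\Big\{x:\ \sup_{0\le\beta\le 1}\Big[H(\beta)+\beta\log(\rho)-\beta I\Big(\frac{x}{\beta}\Big)\Big]<0\Big\},$$ where $H(\beta)=-\beta\log\beta-(1-\beta)\log(1-\beta)$ and $I(x):=\sup_{\gamma>0}\big(x\gamma-\log M(\gamma)\big)$.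
   Context: $\mathcal{N}_i$ is the set of neighbors of node $i$. The adjacency matrix $\mathbf{A}$ has $[\mathbf{A}]_{i,j}=1$ if $\{i,j\}\in\mathcal{E}$ and $0$ otherwise; $\rho$ is the largest absolute value of an eigenvalue of $\mathbf{A}$. The noise samples $v_{ij}(t)$, indexed by ordered pairs $(i,j)$ with $\{i,j\}\in\mathcal{E}$ and times $t=0,1,2,\dots$, are i.i.d. real random variables with zero mean. The initial values $x_1(0),\dots,x_N(0)$ are arbitrary fixed real numbers. The growth rate $\lambda$ is the real constant, known to exist and to be independent of $i$ and of the initial values, such that $\lambda=\lim_{t\to\infty}x_i(t)/t$ almost surely and $\lambda=\lim_{t\to\infty}\mathbb{E}[x_i(t)]/t$ for all $i$. $\log$ is the natural logarithm, $0\log 0=0$; $M(\gamma)$ may be $+\infty$ away from the origin (then $-\log M(\gamma)=-\infty$); at $\beta=0$ the term $\beta I(x/\beta)$ is understood as its limit as $\beta\to 0^+$. *)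

theory Defs
  imports "HOL-Probability.Probability" "Jordan_Normal_Form.Spectral_Radius"
begin

definition simple_graph :: "nat \<Rightarrow> nat set set \<Rightarrow> bool" where
  "simple_graph N E \<longleftrightarrow> E \<subseteq> {{i, j} | i j. i \<in> {1..N} \<and> j \<in> {1..N} \<and> i \<noteq> j}"

definition connected_graph :: "nat \<Rightarrow> nat set set \<Rightarrow> bool" where
  "connected_graph N E \<longleftrightarrow>
     (\<forall>i\<in>{1..N}. \<forall>j\<in>{1..N}. (i, j) \<in> {(a, b). {a, b} \<in> E}\<^sup>*)"

definition neighbors :: "nat set set \<Rightarrow> nat \<Rightarrow> nat set" where
  "neighbors E i = {j. {i, j} \<in> E}"

(* Matrix indices start at 0 while the vertices are 1, ..., N, hence the shift.  The entries are
   complex because spectral_radius is defined for complex matrices; as the matrix is real and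
   symmetric, this does not change its set of eigenvalues. *)
definition adjacency_matrix :: "nat \<Rightarrow> nat set set \<Rightarrow> complex mat" where
  "adjacency_matrix N E = mat N N (\<lambda>(a, b). if {Suc a, Suc b} \<in> E then 1 else 0)"

(* v i j t is the noise sample on the ordered pair (i, j) at time t.  In a connected graph with
   at least two vertices no neighborhood is empty, so Max is well defined. *)
primrec max_consensus ::
    "nat set set \<Rightarrow> (nat \<Rightarrow> nat \<Rightarrow> nat \<Rightarrow> 'a \<Rightarrow> real) \<Rightarrow> (nat \<Rightarrow> real) \<Rightarrow> nat \<Rightarrow> nat \<Rightarrow> 'a \<Rightarrow> real" where
  "max_consensus E v x0 0 i \<omega> = x0 i"
| "max_consensus E v x0 (Suc t) i \<omega> =
     max (max_consensus E v x0 t i \<omega>)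
         (Max ((\<lambda>j. max_consensus E v x0 t j \<omega> + v i j t \<omega>) ` neighbors E i))"

definition is_growth_rate ::
    "'a measure \<Rightarrow> nat \<Rightarrow> nat set set \<Rightarrow> (nat \<Rightarrow> nat \<Rightarrow> nat \<Rightarrow> 'a \<Rightarrow> real) \<Rightarrow> (nat \<Rightarrow> real) \<Rightarrow> real \<Rightarrow> bool"
  where
  "is_growth_rate P N E v x0 l \<longleftrightarrow>
     (\<forall>i\<in>{1..N}. (AE \<omega> in P. (\<lambda>t. max_consensus E v x0 t i \<omega> / real t) \<longlonglongrightarrow> l) \<and>
                 (\<lambda>t. (\<integral>\<omega>. max_consensus E v x0 t i \<omega> \<partial>P) / real t) \<longlonglongrightarrow> l)"

definition mgf :: "real measure \<Rightarrow> real \<Rightarrow> ennreal" where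
  "mgf \<mu> \<gamma> = (\<integral>\<^sup>+ y. ennreal (exp (\<gamma> * y)) \<partial>\<mu>)"

definition log_mgf :: "real measure \<Rightarrow> real \<Rightarrow> ereal" where
  "log_mgf \<mu> \<gamma> = (if mgf \<mu> \<gamma> = \<infinity> then \<infinity> else ereal (ln (enn2real (mgf \<mu> \<gamma>))))"

definition rate_function :: "real measure \<Rightarrow> real \<Rightarrow> ereal" where
  "rate_function \<mu> x = (SUP \<gamma>\<in>{0<..}. ereal (x * \<gamma>) - log_mgf \<mu> \<gamma>)"

(* The expression beta * I(x / beta), extended to beta = 0 by its limit from the right.  If mu is
   centered, then log_mgf is nonnegative, so for fixed x the expression decreases as beta
   increases and the limit exists in the extended reals. *)
definition scaled_rate :: "real measure \<Rightarrow> real \<Rightarrow> real \<Rightarrow> ereal" where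
  "scaled_rate \<mu> \<beta> x =
     (if \<beta> = 0 then Lim (at_right 0) (\<lambda>b. ereal b * rate_function \<mu> (x / b))
      else ereal \<beta> * rate_function \<mu> (x / \<beta>))"

(* The convention 0 log 0 = 0 holds because ln 0 = 0. *)
definition entropy_fun :: "real \<Rightarrow> real" where
  "entropy_fun \<beta> = - \<beta> * ln \<beta> - (1 - \<beta>) * ln (1 - \<beta>)"

end

theory Submission
  imports Defs "HOL-Real_Asymp.Real_Asymp"
begin

text \<open>Unrolling the recursion, \<open>x\<^sub>i(t)\<close> is bounded by the maximum, over all walks from \<open>i\<close> with
  holding times, of the noise collected along the walk.  There are at most
  \<open>C(t, b) * poly(b) * \<rho>^b\<close> walks of duration \<open>t\<close> that make \<open>b\<close> moves, and \<open>C(t, b) \<le> exp (t * H(b / t))\<close>.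
  The samples on a walk have distinct times, hence are independent, so Chernoff's inequality with an
  exponent depending on \<open>\<beta> = b / t\<close> bounds the probability that one walk exceeds \<open>x * t\<close> by roughly
  \<open>exp (- t * \<beta> * I(x / \<beta>))\<close>.  If the supremum over \<open>\<beta>\<close> is negative, the union bound makes
  \<open>P(x\<^sub>i(t) > K + x * t)\<close> vanish, whereas almost sure convergence to a rate above \<open>x\<close> would
  make it tend to 1.\<close>

section \<open>Entropy bound for binomial coefficients\<close>

text \<open>In the binomial distribution with \<open>n\<close> trials and success probability
  \<open>p = k / n\<close>, the outcome \<open>k\<close> has probability at most 1, and the weight
  \<open>p ^ k * (1 - p) ^ (n - k)\<close> is exactly
  \<open>exp (- (n * entropy_fun p))\<close>.\<close>

lemma binomial_le_exp_entropy:
  fixes k n :: nat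
  assumes "k \<le> n"
  shows "real (n choose k) \<le> exp (real n * entropy_fun (real k / real n))"
\<comment> \<open>At the endpoints \<open>p\<close> is 0 or 1, so its powers cannot be written
  through logarithms; both sides equal 1 there.\<close>
proof (cases "k = 0 \<or> k = n")
  case True
  then show ?thesis by (auto simp: entropy_fun_def)
next
  case False
  with assms have k: "0 < k" "k < n" by auto
  define p where "p = real k / real n"
  have p: "0 < p" "p < 1" using k by (auto simp: p_def)
  have exp_ln: "exp (real m * ln x) = x ^ m" if "x > 0" for m x
    using that by (simp add: exp_of_nat_mult)
  have "real (n choose k) * p ^ k * (1 - p) ^ (n - k)
      \<le> (\<Sum>j\<le>n. real (n choose j) * p ^ j * (1 - p) ^ (n - j))"
    using assms p by (intro member_le_sum[of k "{..n}"]) auto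
  also have "\<dots> = (p + (1 - p)) ^ n"
    by (rule binomial_ring[symmetric])
  finally have "real (n choose k) * (p ^ k * (1 - p) ^ (n - k)) \<le> 1"
    by (simp add: mult.assoc)
  moreover have "p ^ k * (1 - p) ^ (n - k) = exp (- (real n * entropy_fun p))"
  proof -
    have "real k = real n * p" "real (n - k) = real n * (1 - p)"
      using k by (auto simp: p_def of_nat_diff algebra_simps)
    then have "- (real n * entropy_fun p) = real k * ln p + real (n - k) * ln (1 - p)"
      by (simp add: entropy_fun_def algebra_simps)
    then show ?thesis
      using p by (simp add: exp_add exp_ln)
  qed
  ultimately show ?thesis
    unfolding p_def[symmetric] by (simp add: exp_minus field_simps)
qed

section \<open>Walk counts and the spectral radius\<close>

primrec walk_count :: "nat set set \<Rightarrow> nat \<Rightarrow> nat \<Rightarrow> nat" where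
  "walk_count E 0 i = 1"
| "walk_count E (Suc b) i = (\<Sum>j\<in>neighbors E i. walk_count E b j)"

lemma neighbors_simple_graph:
  assumes "simple_graph N E"
  shows "neighbors E i \<subseteq> {1..N}" "finite (neighbors E i)"
proof -
  show sub: "neighbors E i \<subseteq> {1..N}"
  proof
    fix j assume "j \<in> neighbors E i"
    then have "{i, j} \<in> E" by (simp add: neighbors_def)
    with assms obtain a b where "{i, j} = {a, b}" "a \<in> {1..N}" "b \<in> {1..N}"
      by (auto simp: simple_graph_def)
    then show "j \<in> {1..N}" by (auto simp: doubleton_eq_iff)
  qed
  then show "finite (neighbors E i)" by (rule finite_subset) simp
qed

text \<open>An eigenvector of the scaled matrix for \<open>k\<close> is one of \<open>A\<close> for
  \<open>r * k\<close>, hence \<open>norm k \<le> 1\<close>. This normalization prepares the Jordan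
  normal form bound, which is polynomial for spectral radius at most 1.\<close>

lemma spectral_radius_smult_le:
  fixes A :: "complex mat"
  assumes A: "A \<in> carrier_mat n n" and n: "n > 0" and r: "r > 0" "spectral_radius A \<le> r"
  shows "spectral_radius (complex_of_real (1 / r) \<cdot>\<^sub>m A) \<le> 1"
proof -
  let ?B = "complex_of_real (1 / r) \<cdot>\<^sub>m A"
  have B: "?B \<in> carrier_mat n n" using A by simp
  obtain k where k: "eigenvalue ?B k" and norm: "spectral_radius ?B = norm k"
    using spectral_radius_mem_max(1)[OF B n] by (auto simp: spectrum_def)
  obtain u where u: "eigenvector ?B u k"
    using k by (auto simp: eigenvalue_def)
  then have carr: "u \<in> carrier_vec n" and eq: "?B *\<^sub>v u = k \<cdot>\<^sub>v u" and nz: "u \<noteq> 0\<^sub>v n"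
    using A by (auto simp: eigenvector_def)
  have "A *\<^sub>v u = complex_of_real r \<cdot>\<^sub>v (?B *\<^sub>v u)"
    using A carr r by (intro eq_vecI) (auto simp: scalar_prod_def sum_distrib_left mult.assoc[symmetric])
  also have "\<dots> = (complex_of_real r * k) \<cdot>\<^sub>v u"
    unfolding eq by (simp only: smult_smult_assoc)
  finally have "eigenvalue A (complex_of_real r * k)"
    using carr nz A by (auto simp: eigenvalue_def eigenvector_def)
  then have "norm (complex_of_real r * k) \<le> spectral_radius A"
    by (intro spectral_radius_mem_max(2)[OF A n]) (auto simp: spectrum_def)
  then have "norm (complex_of_real r * k) \<le> r"
    using r(2) by (rule order.trans)
  then have "norm k \<le> 1"
    using r(1) by (simp add: norm_mult)
  then show ?thesis
    by (simp only: norm)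
qed

text \<open>Columns appear because \<open>pow_mat\<close> multiplies on the right: a column sum of
  the next power combines the column sums at the neighbors of \<open>i\<close>. This is the
  recursion of \<open>walk_count\<close>, since edges are unordered pairs.\<close>

lemma walk_count_eq_column_sum:
  assumes G: "simple_graph N E" and i: "i \<in> {1..N}" and r: "r > 0"
  shows "complex_of_real (real (walk_count E b i) / r ^ b) =
    (\<Sum>a<N. ((complex_of_real (1 / r) \<cdot>\<^sub>m adjacency_matrix N E) ^\<^sub>m b) $$ (a, i - 1))"
  using i
proof (induction b arbitrary: i)
  case 0
  then have "i - 1 < N" by auto
  then show ?case
    by (simp add: adjacency_matrix_def one_mat_def)
next
  case (Suc b)
  let ?A = "adjacency_matrix N E"
  let ?B = "complex_of_real (1 / r) \<cdot>\<^sub>m ?A"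
  have A: "?A \<in> carrier_mat N N" by (simp add: adjacency_matrix_def)
  then have B: "?B \<in> carrier_mat N N" by simp
  then have Bb: "?B ^\<^sub>m b \<in> carrier_mat N N" by (rule pow_carrier_mat)
  have i: "i - 1 < N" "Suc (i - 1) = i" using Suc.prems by auto
  have entry: "?B $$ (k, i - 1) = (if Suc k \<in> neighbors E i then complex_of_real (1 / r) else 0)"
    if "k < N" for k
    using that i by (simp add: adjacency_matrix_def neighbors_def insert_commute)
  have "(\<Sum>a<N. (?B ^\<^sub>m Suc b) $$ (a, i - 1))
      = (\<Sum>a<N. \<Sum>k<N. (?B ^\<^sub>m b) $$ (a, k) * ?B $$ (k, i - 1))"
  proof (intro sum.cong refl)
    fix a assume "a \<in> {..<N}"
    then have "(?B ^\<^sub>m Suc b) $$ (a, i - 1) = row (?B ^\<^sub>m b) a \<bullet> col ?B (i - 1)"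
      using carrier_matD[OF B] carrier_matD[OF Bb] i by (simp only: pow_mat.simps index_mult_mat) simp
    then show "(?B ^\<^sub>m Suc b) $$ (a, i - 1) = (\<Sum>k<N. (?B ^\<^sub>m b) $$ (a, k) * ?B $$ (k, i - 1))"
      using \<open>a \<in> {..<N}\<close> carrier_matD[OF B] carrier_matD[OF Bb] i
      by (simp add: scalar_prod_def atLeast0LessThan)
  qed
  also have "\<dots> = (\<Sum>k<N. (\<Sum>a<N. (?B ^\<^sub>m b) $$ (a, k)) * ?B $$ (k, i - 1))"
    by (subst sum.swap) (simp add: sum_distrib_right)
  also have "\<dots> = (\<Sum>k<N. if Suc k \<in> neighbors E i
      then complex_of_real (real (walk_count E b (Suc k)) / r ^ Suc b) else 0)"
  proof (intro sum.cong refl)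
    fix k assume k: "k \<in> {..<N}"
    then have "(\<Sum>a<N. (?B ^\<^sub>m b) $$ (a, k)) = complex_of_real (real (walk_count E b (Suc k)) / r ^ b)"
      using Suc.IH[of "Suc k"] by simp
    moreover have "?B $$ (k, i - 1) = (if Suc k \<in> neighbors E i then complex_of_real (1 / r) else 0)"
      using k by (intro entry) simp
    ultimately show "(\<Sum>a<N. (?B ^\<^sub>m b) $$ (a, k)) * ?B $$ (k, i - 1) = (if Suc k \<in> neighbors E i
      then complex_of_real (real (walk_count E b (Suc k)) / r ^ Suc b) else 0)"
      by (simp only:) simp
  qed
  also have "\<dots> = (\<Sum>j\<in>{1..N}. if j \<in> neighbors E i
      then complex_of_real (real (walk_count E b j) / r ^ Suc b) else 0)"
    by (rule sum.reindex_bij_witness[of _ "\<lambda>j. j - 1" Suc]) auto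
  also have "\<dots> = (\<Sum>j\<in>neighbors E i. complex_of_real (real (walk_count E b j) / r ^ Suc b))"
    using neighbors_simple_graph(1)[OF G, of i]
    by (subst sum.inter_restrict[symmetric]) (auto simp: Int_absorb1)
  also have "\<dots> = complex_of_real (real (walk_count E (Suc b) i) / r ^ Suc b)"
    by (simp add: sum_divide_distrib)
  finally show ?case ..
qed

text \<open>If the spectral radius is 0, the factor \<open>exp (b * ln 0)\<close> is 1 because \<open>ln 0 = 0\<close>, so the bound
  holds without a case distinction.\<close>

lemma walk_count_bound:
  assumes G: "simple_graph N E" and N: "N > 0"
  obtains c d where "c \<ge> 0" "d \<ge> 0" "\<And>b i. i \<in> {1..N} \<Longrightarrow> real (walk_count E b i)
    \<le> (c + d * real b ^ (N - 1)) * exp (real b * ln (spectral_radius (adjacency_matrix N E)))"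
proof -
  define \<rho> where "\<rho> = spectral_radius (adjacency_matrix N E)"
  \<comment> \<open>The scaling needs a positive number; replacing 0 by 1 preserves the logarithm,
    as \<open>ln 0 = ln 1\<close>.\<close>
  define r where "r = (if \<rho> = 0 then 1 else \<rho>)"
  let ?A = "adjacency_matrix N E"
  let ?B = "complex_of_real (1 / r) \<cdot>\<^sub>m ?A"
  have A: "?A \<in> carrier_mat N N" by (simp add: adjacency_matrix_def)
  then have B: "?B \<in> carrier_mat N N" by simp
  have "\<rho> \<ge> 0"
    using spectral_radius_mem_max(1)[OF A N] by (auto simp: \<rho>_def)
  then have r: "r > 0" "\<rho> \<le> r" "ln r = ln \<rho>" by (auto simp: r_def)
  have "spectral_radius ?B \<le> 1"
    using spectral_radius_smult_le[OF A N r(1)] r(2) by (simp add: \<rho>_def)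
  \<comment> \<open>Jordan blocks have size at most \<open>N\<close> and eigenvalues of modulus at
    most 1, so entries of powers grow at most like \<open>b ^ (N - 1)\<close>.\<close>
  from spectral_radius_jnf_norm_bound_le_1_upper_triangular[OF B this]
  obtain c d where cd: "norm_bound (?B ^\<^sub>m b) (c + d * of_nat b ^ (N - 1))" for b
    by blast
  \<comment> \<open>The factor \<open>N\<close> is the length of a column; the absolute values make
    both constants nonnegative.\<close>
  have "real (walk_count E b i) \<le> (real N * \<bar>c\<bar> + real N * \<bar>d\<bar> * real b ^ (N - 1)) * exp (real b * ln \<rho>)"
    if i: "i \<in> {1..N}" for b i
  proof -
    have Bb: "?B ^\<^sub>m b \<in> carrier_mat N N" using B by (rule pow_carrier_mat)
    have "real (walk_count E b i) / r ^ b = norm (complex_of_real (real (walk_count E b i) / r ^ b))"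
      using r by (simp only: norm_of_real) simp
    also have "\<dots> \<le> (\<Sum>a<N. norm ((?B ^\<^sub>m b) $$ (a, i - 1)))"
      unfolding walk_count_eq_column_sum[OF G i r(1)] by (rule norm_sum)
    also have "\<dots> \<le> (\<Sum>a<N. \<bar>c\<bar> + \<bar>d\<bar> * real b ^ (N - 1))"
    proof (intro sum_mono)
      fix a assume a: "a \<in> {..<N}"
      have "norm ((?B ^\<^sub>m b) $$ (a, i - 1)) \<le> c + d * real b ^ (N - 1)"
        using cd[of b] a i carrier_matD[OF Bb] unfolding norm_bound_def by auto
      also have "\<dots> \<le> \<bar>c\<bar> + \<bar>d\<bar> * real b ^ (N - 1)"
        by (intro add_mono mult_right_mono) auto
      finally show "norm ((?B ^\<^sub>m b) $$ (a, i - 1)) \<le> \<bar>c\<bar> + \<bar>d\<bar> * real b ^ (N - 1)" .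
    qed
    finally have "real (walk_count E b i) \<le> (real N * \<bar>c\<bar> + real N * \<bar>d\<bar> * real b ^ (N - 1)) * r ^ b"
      using r by (simp add: field_simps)
    also have "r ^ b = exp (real b * ln \<rho>)"
      using r by (simp add: exp_of_nat_mult flip: r(3))
    finally show ?thesis .
  qed
  then show thesis
    using that[of "real N * \<bar>c\<bar>" "real N * \<bar>d\<bar>"] by (simp add: \<rho>_def)
qed

section \<open>Walks with holding times\<close>

text \<open>A walk with holding times is represented by the set of indices of the noise samples that it
  collects.\<close>

primrec move_sets :: "nat set set \<Rightarrow> nat \<Rightarrow> nat \<Rightarrow> nat \<Rightarrow> (nat \<times> nat \<times> nat) set set" where
  "move_sets E 0 b i = (if b = 0 then {{}} else {})"
| "move_sets E (Suc t) b i = move_sets E t b i \<union>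
     (case b of 0 \<Rightarrow> {} | Suc b' \<Rightarrow> \<Union>j\<in>neighbors E i. insert (i, j, t) ` move_sets E t b' j)"

text \<open>The sample added at time \<open>t\<close> is new, because the rest of the walk uses
  earlier times only. So no sample is collected twice, and each set lies within the index set of the
  independent family.\<close>

lemma move_sets_memD:
  assumes "w \<in> move_sets E t b i"
  shows "finite w \<and> card w = b \<and> w \<subseteq> {(i, j, s). {i, j} \<in> E \<and> s < t}"
  using assms
proof (induction t arbitrary: w b i)
  case 0
  then show ?case by (auto split: if_splits)
next
  case (Suc t)
  show ?case
  proof (cases "w \<in> move_sets E t b i")
    case True
    then show ?thesis using Suc.IH[of w b i] by auto
  next
    case False
    with Suc.prems obtain b' j w' where w: "b = Suc b'" "j \<in> neighbors E i"
        "w' \<in> move_sets E t b' j" "w = insert (i, j, t) w'"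
      by (auto split: nat.splits)
    have IH: "finite w'" "card w' = b'" "w' \<subseteq> {(i, j, s). {i, j} \<in> E \<and> s < t}"
      using Suc.IH[OF w(3)] by auto
    then have "(i, j, t) \<notin> w'" by auto
    with IH w show ?thesis by (auto simp: neighbors_def)
  qed
qed

text \<open>Pascal's rule: at time \<open>t\<close> the walk either holds, leaving \<open>b\<close>
  moves for \<open>t\<close> steps, or moves, leaving \<open>b - 1\<close>. Overlaps between the
  images only lower the cardinality.\<close>

lemma card_move_sets_le:
  assumes "\<And>i. finite (neighbors E i)"
  shows "finite (move_sets E t b i) \<and> card (move_sets E t b i) \<le> (t choose b) * walk_count E b i"
proof (induction t arbitrary: b i)
  case 0
  then show ?case by (cases b) auto
next
  case (Suc t)
  show ?case
  proof (cases b)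
    case 0
    then show ?thesis using Suc.IH[of b i] by simp
  next
    case b: (Suc b')
    let ?U = "\<Union>j\<in>neighbors E i. insert (i, j, t) ` move_sets E t b' j"
    have "card ?U \<le> (\<Sum>j\<in>neighbors E i. card (insert (i, j, t) ` move_sets E t b' j))"
      using assms by (rule card_UN_le)
    also have "\<dots> \<le> (\<Sum>j\<in>neighbors E i. (t choose b') * walk_count E b' j)"
      using Suc.IH by (intro sum_mono order.trans[OF card_image_le]) auto
    also have "\<dots> = (t choose b') * walk_count E b i"
      by (simp add: b sum_distrib_left)
    finally have "card (move_sets E t b i \<union> ?U)
        \<le> (t choose b) * walk_count E b i + (t choose b') * walk_count E b i"
      using Suc.IH[of b i] by (intro order.trans[OF card_Un_le] add_mono) auto
    moreover have "finite ?U"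
      using assms Suc.IH by auto
    ultimately show ?thesis
      using Suc.IH[of b i] by (simp add: b algebra_simps)
  qed
qed

text \<open>The maximizers are traced backwards in time from \<open>i\<close>: the walk holds when
  the old value wins, and otherwise moves to a maximizing neighbor and collects its sample. At time
  0 the initial value reached is at most \<open>K\<close>.\<close>

lemma max_consensus_le_move_sets:
  assumes fin: "\<And>i. finite (neighbors E i)"
    and nb: "\<And>i. i \<in> V \<Longrightarrow> neighbors E i \<noteq> {} \<and> neighbors E i \<subseteq> V"
    and K: "\<And>i. i \<in> V \<Longrightarrow> x0 i \<le> K" and i: "i \<in> V"
  shows "\<exists>b\<le>t. \<exists>w\<in>move_sets E t b i.
    max_consensus E v x0 t i \<omega> \<le> K + (\<Sum>e\<in>w. (\<lambda>(i, j, s). v i j s) e \<omega>)"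
  using i
proof (induction t arbitrary: i)
  case 0
  then show ?case using K by auto
next
  case (Suc t)
  let ?X = "\<lambda>e. (\<lambda>(i, j, s). v i j s) e \<omega>"
  let ?M = "Max ((\<lambda>j. max_consensus E v x0 t j \<omega> + v i j t \<omega>) ` neighbors E i)"
  show ?case
  proof (cases "?M \<le> max_consensus E v x0 t i \<omega>")
    case True
    obtain b w where "b \<le> t" "w \<in> move_sets E t b i" "max_consensus E v x0 t i \<omega> \<le> K + (\<Sum>e\<in>w. ?X e)"
      using Suc.IH[OF Suc.prems] by blast
    with True show ?thesis
      by (intro exI[of _ b] conjI bexI[of _ w]) auto
  next
    case False
    have "?M \<in> (\<lambda>j. max_consensus E v x0 t j \<omega> + v i j t \<omega>) ` neighbors E i"
      using fin nb[OF Suc.prems] by (intro Max_in) auto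
    then obtain j where j: "j \<in> neighbors E i" and M: "?M = max_consensus E v x0 t j \<omega> + v i j t \<omega>"
      by auto
    obtain b w where w: "b \<le> t" "w \<in> move_sets E t b j" "max_consensus E v x0 t j \<omega> \<le> K + (\<Sum>e\<in>w. ?X e)"
      using Suc.IH[of j] j nb[OF Suc.prems] by blast
    \<comment> \<open>Freshness of the index makes the sum over the enlarged set grow by exactly
      \<open>v i j t\<close>.\<close>
    have "finite w" "(i, j, t) \<notin> w"
      using move_sets_memD[OF w(2)] by auto
    with w M False have "max_consensus E v x0 (Suc t) i \<omega> \<le> K + (\<Sum>e\<in>insert (i, j, t) w. ?X e)"
      by (simp add: max_def)
    moreover have "insert (i, j, t) w \<in> move_sets E (Suc t) (Suc b) i"
      using j w(2) by auto
    ultimately show ?thesis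
      using w(1) by (intro exI[of _ "Suc b"] conjI) blast+
  qed
qed

lemma measurable_max_consensus:
  assumes fin: "\<And>i. finite (neighbors E i)"
    and nb: "\<And>i. i \<in> V \<Longrightarrow> neighbors E i \<noteq> {} \<and> neighbors E i \<subseteq> V"
    and meas: "\<And>i j t. {i, j} \<in> E \<Longrightarrow> v i j t \<in> borel_measurable M" and i: "i \<in> V"
  shows "max_consensus E v x0 t i \<in> borel_measurable M"
  using i
proof (induction t arbitrary: i)
  case 0
  have "max_consensus E v x0 0 i = (\<lambda>\<omega>. x0 i)" by (simp add: fun_eq_iff)
  then show ?case by simp
next
  case (Suc t)
  have "(\<lambda>\<omega>. Max ((\<lambda>j. max_consensus E v x0 t j \<omega> + v i j t \<omega>) ` neighbors E i)) \<in> borel_measurable M"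
    using Suc.IH nb[OF Suc.prems] fin meas
    by (intro borel_measurable_Max borel_measurable_add) (auto simp: neighbors_def)
  then have "(\<lambda>\<omega>. max_consensus E v x0 (Suc t) i \<omega>) \<in> borel_measurable M"
    using Suc by (auto intro!: borel_measurable_max)
  then show ?case by simp
qed

section \<open>Chernoff bound, moment generating function and rate function\<close>

text \<open>Markov's inequality is applied to \<open>exp (\<gamma> * (S - a))\<close> for the sum
  \<open>S\<close>; independence turns the expectation of the exponential into the product of
  \<open>card w\<close> equal factors \<open>m\<close>.\<close>

lemma (in prob_space) chernoff_sum:
  fixes X :: "'i \<Rightarrow> 'a \<Rightarrow> real"
  assumes indep: "indep_vars (\<lambda>_. borel) X w" and fin: "finite w"
    and ident: "\<And>e. e \<in> w \<Longrightarrow> distr M borel (X e) = \<mu>"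
    and \<gamma>: "\<gamma> > 0" and \<mu>: "mgf \<mu> \<gamma> = ennreal m" and m: "m > 0"
  shows "prob {\<omega>\<in>space M. a < (\<Sum>e\<in>w. X e \<omega>)} \<le> exp (real (card w) * ln m - \<gamma> * a)"
proof -
  have meas[measurable]: "X e \<in> borel_measurable M" if "e \<in> w" for e
    using indep that by (auto simp: indep_vars_def)
  let ?S = "\<lambda>\<omega>. \<Sum>e\<in>w. X e \<omega>"
  have S[measurable]: "?S \<in> borel_measurable M"
    by (intro borel_measurable_sum meas)
  have "emeasure M {\<omega>\<in>space M. a < ?S \<omega>}
      \<le> emeasure M {\<omega>\<in>space M. 1 \<le> ennreal (exp (- \<gamma> * a)) * ennreal (exp (\<gamma> * ?S \<omega>))}"
    using \<gamma> by (intro emeasure_mono) (auto simp: ennreal_mult'[symmetric] exp_add[symmetric])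
  also have "\<dots> \<le> ennreal (exp (- \<gamma> * a)) * (\<integral>\<^sup>+\<omega>. ennreal (exp (\<gamma> * ?S \<omega>)) * indicator (space M) \<omega> \<partial>M)"
    by (intro nn_integral_Markov_inequality) auto
  also have "(\<integral>\<^sup>+\<omega>. ennreal (exp (\<gamma> * ?S \<omega>)) * indicator (space M) \<omega> \<partial>M)
      = (\<integral>\<^sup>+\<omega>. (\<Prod>e\<in>w. ennreal (exp (\<gamma> * X e \<omega>))) \<partial>M)"
    using fin by (intro nn_integral_cong) (simp add: exp_sum sum_distrib_left prod_ennreal)
  also have "\<dots> = (\<Prod>e\<in>w. \<integral>\<^sup>+\<omega>. ennreal (exp (\<gamma> * X e \<omega>)) \<partial>M)"
    by (intro indep_vars_nn_integral fin indep_vars_compose2[OF indep]) auto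
  also have "\<dots> = (\<Prod>e\<in>w. ennreal m)"
  proof (intro prod.cong refl)
    fix e assume e: "e \<in> w"
    have "(\<integral>\<^sup>+\<omega>. ennreal (exp (\<gamma> * X e \<omega>)) \<partial>M) = (\<integral>\<^sup>+y. ennreal (exp (\<gamma> * y)) \<partial>distr M borel (X e))"
      using meas[OF e] by (subst nn_integral_distr) auto
    then show "(\<integral>\<^sup>+\<omega>. ennreal (exp (\<gamma> * X e \<omega>)) \<partial>M) = ennreal m"
      using \<mu> by (simp add: ident[OF e] mgf_def)
  qed
  also have "ennreal (exp (- \<gamma> * a)) * \<dots> = ennreal (exp (- \<gamma> * a) * m ^ card w)"
    using m by (simp add: ennreal_mult ennreal_power)
  also have "exp (- \<gamma> * a) * m ^ card w = exp (real (card w) * ln m - \<gamma> * a)"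
    using m by (simp add: exp_diff exp_minus exp_of_nat_mult divide_inverse)
  finally show ?thesis
    by (simp add: emeasure_eq_measure)
qed

text \<open>Integrate \<open>1 + \<gamma> * y \<le> exp (\<gamma> * y)\<close>; the linear term
  vanishes by the zero mean.\<close>

lemma mgf_ge_1:
  assumes "prob_space \<mu>" and mean: "integrable \<mu> (\<lambda>y. y)" "(\<integral>y. y \<partial>\<mu>) = 0"
  shows "1 \<le> mgf \<mu> \<gamma>"
proof (cases "mgf \<mu> \<gamma> = \<infinity>")
  case False
  interpret prob_space \<mu> by fact
  have [measurable]: "(\<lambda>y. y) \<in> borel_measurable \<mu>"
    using mean(1) by (rule borel_measurable_integrable)
  have int: "integrable \<mu> (\<lambda>y. exp (\<gamma> * y))"
    using False by (intro integrableI_nonneg) (auto simp: mgf_def less_top)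
  have "1 = (\<integral>y. 1 + \<gamma> * y \<partial>\<mu>)"
    using mean by (simp add: prob_space)
  also have "\<dots> \<le> (\<integral>y. exp (\<gamma> * y) \<partial>\<mu>)"
    using mean int by (intro integral_mono) auto
  finally have "ennreal 1 \<le> ennreal (\<integral>y. exp (\<gamma> * y) \<partial>\<mu>)"
    by (rule ennreal_leI)
  also have "\<dots> = mgf \<mu> \<gamma>"
    using int by (simp add: mgf_def nn_integral_eq_integral)
  finally show ?thesis by simp
qed simp

lemma rate_function_nonpos:
  assumes "\<And>\<gamma>. 1 \<le> mgf \<mu> \<gamma>" and "x \<le> 0"
  shows "rate_function \<mu> x \<le> 0"
  unfolding rate_function_def
proof (rule SUP_least)
  fix \<gamma> :: real assume \<gamma>: "\<gamma> \<in> {0<..}"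
  have "0 \<le> log_mgf \<mu> \<gamma>"
  proof (cases "mgf \<mu> \<gamma> = \<infinity>")
    case False
    then have "1 \<le> enn2real (mgf \<mu> \<gamma>)"
      using enn2real_mono[OF assms(1)[of \<gamma>]] by (simp add: less_top)
    with False show ?thesis by (simp add: log_mgf_def)
  qed (simp add: log_mgf_def)
  moreover have "ereal (x * \<gamma>) \<le> 0"
    using \<gamma> assms(2) by (simp add: mult_nonpos_nonneg)
  ultimately show "ereal (x * \<gamma>) - log_mgf \<mu> \<gamma> \<le> 0"
    using ereal_minus_mono[of "ereal (x * \<gamma>)" 0 0 "log_mgf \<mu> \<gamma>"] by simp
qed

text \<open>A value strictly below the supremum is exceeded at some \<open>\<gamma>\<close>, so no
  maximizer has to exist. An infinite \<open>mgf\<close> would give the term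
  \<open>-\<infinity>\<close>, so \<open>m\<close> is finite there, and positive because
  \<open>mgf\<close> is at least 1.\<close>

lemma less_scaled_rateE:
  assumes "\<And>\<gamma>. 1 \<le> mgf \<mu> \<gamma>" and \<beta>: "\<beta> > 0" and less: "ereal a < scaled_rate \<mu> \<beta> x"
  obtains \<gamma> m where "\<gamma> > 0" "m > 0" "mgf \<mu> \<gamma> = ennreal m" "a < x * \<gamma> - \<beta> * ln m"
proof -
  have "ereal (a / \<beta>) < rate_function \<mu> (x / \<beta>)"
    using less \<beta> by (cases "rate_function \<mu> (x / \<beta>)") (auto simp: scaled_rate_def field_simps)
  then obtain \<gamma> where \<gamma>: "\<gamma> > 0" and g: "ereal (a / \<beta>) < ereal (x / \<beta> * \<gamma>) - log_mgf \<mu> \<gamma>"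
    by (auto simp: rate_function_def less_SUP_iff)
  then have fin: "mgf \<mu> \<gamma> \<noteq> \<infinity>"
    by (auto simp: log_mgf_def)
  define m where "m = enn2real (mgf \<mu> \<gamma>)"
  have m: "mgf \<mu> \<gamma> = ennreal m"
    using fin by (simp add: m_def less_top)
  with assms(1)[of \<gamma>] have "m > 0"
    by (cases "m > 0") (auto simp: ennreal_neg not_less)
  moreover have "a < x * \<gamma> - \<beta> * ln m"
    using g fin \<beta> by (simp add: log_mgf_def m_def[symmetric] field_simps)
  ultimately show thesis using that \<gamma> m by blast
qed

text \<open>The point \<open>r / (1 + r)\<close> maximizes
  \<open>entropy_fun \<beta> + \<beta> * ln r\<close> on the unit interval; the value there is
  positive.\<close>

lemma entropy_fun_odds:
  assumes "r > 0"
  shows "entropy_fun (r / (1 + r)) + r / (1 + r) * ln r = ln (1 + r)"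
proof -
  have compl: "1 - r / (1 + r) = 1 / (1 + r)"
    using assms by (simp add: field_simps)
  have "entropy_fun (r / (1 + r)) + r / (1 + r) * ln r
      = - (r / (1 + r)) * (ln r - ln (1 + r)) - 1 / (1 + r) * (0 - ln (1 + r)) + r / (1 + r) * ln r"
    unfolding entropy_fun_def compl using assms by (simp add: ln_div)
  also have "\<dots> = (r / (1 + r) + 1 / (1 + r)) * ln (1 + r)"
    by (simp add: ring_distribs)
  also have "r / (1 + r) + 1 / (1 + r) = 1"
    using assms by (simp add: field_simps)
  finally show ?thesis by simp
qed

text \<open>For negative \<open>x\<close> the rate term is nonpositive, while entropy plus
  \<open>\<beta> * ln \<rho>\<close> is positive at its maximizer, contradicting the condition. The
  sign of \<open>x\<close> is what handles the walk without moves.\<close>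

lemma nonneg_of_rate_condition:
  assumes "\<And>\<gamma>. 1 \<le> mgf \<mu> \<gamma>" and \<rho>: "\<rho> \<ge> 0"
    and sup: "\<And>\<beta>. \<beta> \<in> {0..1} \<Longrightarrow> ereal (entropy_fun \<beta> + \<beta> * ln \<rho>) - scaled_rate \<mu> \<beta> x < 0"
  shows "x \<ge> 0"
proof (rule ccontr)
  assume x: "\<not> x \<ge> 0"
  \<comment> \<open>Since \<open>ln 0 = ln 1\<close>, the case \<open>\<rho> = 0\<close> is treated
    as \<open>\<rho> = 1\<close>.\<close>
  define r where "r = (if \<rho> = 0 then 1 else \<rho>)"
  have r: "r > 0" "ln r = ln \<rho>" using \<rho> by (auto simp: r_def)
  define \<beta> where "\<beta> = r / (1 + r)"
  have \<beta>: "0 < \<beta>" "\<beta> \<le> 1" using r by (auto simp: \<beta>_def)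
  have "rate_function \<mu> (x / \<beta>) \<le> 0"
    using assms(1) x \<beta> by (intro rate_function_nonpos) (auto simp: divide_nonpos_pos)
  then have "scaled_rate \<mu> \<beta> x \<le> 0"
    using \<beta> by (simp add: scaled_rate_def ereal_mult_le_0_iff)
  moreover have "entropy_fun \<beta> + \<beta> * ln \<rho> > 0"
    using entropy_fun_odds[OF r(1)] r by (simp add: \<beta>_def)
  ultimately have "0 \<le> ereal (entropy_fun \<beta> + \<beta> * ln \<rho>) - scaled_rate \<mu> \<beta> x"
    by (cases "scaled_rate \<mu> \<beta> x") auto
  with sup[of \<beta>] \<beta> show False by auto
qed

section \<open>Union bound over all walks\<close>

text \<open>Walks are grouped in layers by their number of moves \<open>b\<close>. The exponent
  \<open>\<gamma>\<close> may vary with \<open>\<beta> = b / t\<close>, but the gain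
  \<open>\<delta>\<close> is uniform, so every layer decays like
  \<open>exp (- (\<delta> * t))\<close> up to a polynomial.\<close>

lemma (in prob_space) max_consensus_tail_tendsto_0:
  fixes v :: "nat \<Rightarrow> nat \<Rightarrow> nat \<Rightarrow> 'a \<Rightarrow> real"
  assumes G: "simple_graph N E" and nb: "\<And>i. i \<in> {1..N} \<Longrightarrow> neighbors E i \<noteq> {}"
    and indep: "indep_vars (\<lambda>_. borel) (\<lambda>(i, j, t). v i j t) {(i, j, t). {i, j} \<in> E}"
    and ident: "\<And>i j t. {i, j} \<in> E \<Longrightarrow> distr M borel (v i j t) = \<mu>"
    and x: "x \<ge> 0" and \<delta>: "\<delta> > 0"
    and rate: "\<And>\<beta>. 0 < \<beta> \<Longrightarrow> \<beta> \<le> 1 \<Longrightarrow> \<exists>\<gamma> m. \<gamma> > 0 \<and> m > 0 \<and> mgf \<mu> \<gamma> = ennreal m \<and>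
      entropy_fun \<beta> + \<beta> * ln (spectral_radius (adjacency_matrix N E)) + \<delta> < x * \<gamma> - \<beta> * ln m"
    and K: "\<And>i. i \<in> {1..N} \<Longrightarrow> x0 i \<le> K" and i: "i \<in> {1..N}"
  shows "(\<lambda>t. prob {\<omega>\<in>space M. K + x * real t < max_consensus E v x0 t i \<omega>}) \<longlonglongrightarrow> 0"
proof -
  let ?X = "\<lambda>(i, j, t). v i j t"
  let ?\<rho> = "spectral_radius (adjacency_matrix N E)"
  have N: "N > 0" using i by auto
  obtain c d where c: "c \<ge> 0" and d: "d \<ge> 0"
    and wc: "\<And>b i. i \<in> {1..N} \<Longrightarrow> real (walk_count E b i)
      \<le> (c + d * real b ^ (N - 1)) * exp (real b * ln ?\<rho>)"
    using walk_count_bound[OF G N] by metis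
  note nbs = neighbors_simple_graph[OF G]
  have meas: "?X e \<in> borel_measurable M" if "e \<in> {(i, j, t). {i, j} \<in> E}" for e
    using indep that unfolding indep_vars_def by blast
  define D where "D w y = {\<omega>\<in>space M. y < (\<Sum>e\<in>w. ?X e \<omega>)}" for w y
  \<comment> \<open>A bound common to all layers: the polynomial in \<open>b\<close> is replaced by
    its value at \<open>t\<close>.\<close>
  define q where "q t = (c + d * real t ^ (N - 1)) * exp (- (\<delta> * real t))" for t :: nat
  have D: "D w y \<in> events" if "w \<in> move_sets E t b i" for w t b y
  proof -
    have [measurable]: "(\<lambda>\<omega>. \<Sum>e\<in>w. ?X e \<omega>) \<in> borel_measurable M"
      using move_sets_memD[OF that] by (intro borel_measurable_sum meas) auto
    show ?thesis unfolding D_def by measurable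
  qed
  have q: "q t \<ge> 0" for t using c d by (auto simp: q_def)
  have layer: "(\<Sum>w\<in>move_sets E t b i. prob (D w (x * real t))) \<le> q t"
    if b: "b \<le> t" and t: "t > 0" for t b
  proof (cases "b = 0")
    case True
    \<comment> \<open>Without moves the collected noise is the empty sum 0, which cannot exceed
      \<open>x * t\<close>.\<close>
    have "D w (x * real t) = {}" if "w \<in> move_sets E t b i" for w
      using move_sets_memD[OF that] True x by (auto simp: D_def not_less)
    then show ?thesis using q by simp
  next
    case False
    define \<beta> where "\<beta> = real b / real t"
    have \<beta>: "0 < \<beta>" "\<beta> \<le> 1" and b_eq: "real b = real t * \<beta>"
      using False b t by (auto simp: \<beta>_def)
    obtain \<gamma> m where \<gamma>: "\<gamma> > 0" "m > 0" "mgf \<mu> \<gamma> = ennreal m"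
      and less: "entropy_fun \<beta> + \<beta> * ln ?\<rho> + \<delta> < x * \<gamma> - \<beta> * ln m"
      using rate[OF \<beta>] by blast
    have "(\<Sum>w\<in>move_sets E t b i. prob (D w (x * real t)))
        \<le> (\<Sum>w\<in>move_sets E t b i. exp (real b * ln m - \<gamma> * (x * real t)))"
    proof (rule sum_mono)
      fix w assume "w \<in> move_sets E t b i"
      note w = move_sets_memD[OF this]
      then have "w \<subseteq> {(i, j, t). {i, j} \<in> E}" by auto
      then have "indep_vars (\<lambda>_. borel) ?X w" "\<And>e. e \<in> w \<Longrightarrow> distr M borel (?X e) = \<mu>"
        using indep_vars_subset[OF indep] ident by (blast, fastforce)
      with chernoff_sum[of ?X w \<mu> \<gamma> m "x * real t"] w \<gamma>
      show "prob (D w (x * real t)) \<le> exp (real b * ln m - \<gamma> * (x * real t))"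
        by (simp add: D_def)
    qed
    also have "\<dots> = real (card (move_sets E t b i)) * exp (real b * ln m - \<gamma> * (x * real t))"
      by simp
    also have "\<dots> \<le> (real (t choose b) * real (walk_count E b i)) * exp (real b * ln m - \<gamma> * (x * real t))"
      using card_move_sets_le[of E t b i] nbs(2)
      by (intro mult_right_mono) (auto simp flip: of_nat_mult)
    also have "\<dots> \<le> (exp (real t * entropy_fun \<beta>) * ((c + d * real t ^ (N - 1)) * exp (real b * ln ?\<rho>)))
        * exp (real b * ln m - \<gamma> * (x * real t))"
    proof (intro mult_right_mono mult_mono)
      show "real (t choose b) \<le> exp (real t * entropy_fun \<beta>)"
        unfolding \<beta>_def using b by (rule binomial_le_exp_entropy)
      have "(c + d * real b ^ (N - 1)) * exp (real b * ln ?\<rho>) \<le> (c + d * real t ^ (N - 1)) * exp (real b * ln ?\<rho>)"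
        using b d by (intro mult_right_mono add_left_mono mult_left_mono power_mono) auto
      with wc[OF i, of b] show "real (walk_count E b i) \<le> (c + d * real t ^ (N - 1)) * exp (real b * ln ?\<rho>)"
        by linarith
    qed (use c d in auto)
    \<comment> \<open>Substituting \<open>b = t * \<beta>\<close> puts entropy, walk growth and the
      Chernoff exponent under one factor \<open>t\<close>.\<close>
    also have "\<dots> = (c + d * real t ^ (N - 1))
        * exp (real t * (entropy_fun \<beta> + \<beta> * ln ?\<rho> - (x * \<gamma> - \<beta> * ln m)))"
      unfolding b_eq by (simp add: exp_add exp_diff right_diff_distrib distrib_left mult_ac)
    also have "\<dots> \<le> q t"
    proof -
      have "real t * (entropy_fun \<beta> + \<beta> * ln ?\<rho> - (x * \<gamma> - \<beta> * ln m)) \<le> real t * (- \<delta>)"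
        using less by (intro mult_left_mono) auto
      then show ?thesis
        unfolding q_def using c d by (intro mult_left_mono) (auto simp: mult.commute)
    qed
    finally show ?thesis .
  qed
  \<comment> \<open>The factor \<open>t + 1\<close> counts the layers
    \<open>b = 0, ..., t\<close>.\<close>
  have bound: "prob {\<omega>\<in>space M. K + x * real t < max_consensus E v x0 t i \<omega>} \<le> (real t + 1) * q t"
    if t: "t > 0" for t
  proof -
    have fin: "finite (move_sets E t b i)" for b
      using card_move_sets_le[of E t b i] nbs(2) by simp
    have "prob {\<omega>\<in>space M. K + x * real t < max_consensus E v x0 t i \<omega>}
        \<le> prob (\<Union>b\<in>{..t}. \<Union>w\<in>move_sets E t b i. D w (x * real t))"
    proof (rule finite_measure_mono)
      show "{\<omega>\<in>space M. K + x * real t < max_consensus E v x0 t i \<omega>}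
          \<subseteq> (\<Union>b\<in>{..t}. \<Union>w\<in>move_sets E t b i. D w (x * real t))"
      proof
        fix \<omega> assume \<omega>: "\<omega> \<in> {\<omega>\<in>space M. K + x * real t < max_consensus E v x0 t i \<omega>}"
        have "\<exists>b\<le>t. \<exists>w\<in>move_sets E t b i.
            max_consensus E v x0 t i \<omega> \<le> K + (\<Sum>e\<in>w. ?X e \<omega>)"
          using nbs nb K i by (intro max_consensus_le_move_sets[of E "{1..N}"]) auto
        then obtain b w where "b \<le> t" "w \<in> move_sets E t b i"
          "max_consensus E v x0 t i \<omega> \<le> K + (\<Sum>e\<in>w. ?X e \<omega>)" by blast
        moreover from this(3) \<omega> have "\<omega> \<in> D w (x * real t)"
          by (simp add: D_def)
        ultimately show "\<omega> \<in> (\<Union>b\<in>{..t}. \<Union>w\<in>move_sets E t b i. D w (x * real t))"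
          by blast
      qed
      show "(\<Union>b\<in>{..t}. \<Union>w\<in>move_sets E t b i. D w (x * real t)) \<in> events"
        using fin D by (intro sets.finite_UN) auto
    qed
    also have "\<dots> \<le> (\<Sum>b\<in>{..t}. prob (\<Union>w\<in>move_sets E t b i. D w (x * real t)))"
      using fin D by (intro finite_measure_subadditive_finite) (auto intro!: sets.finite_UN)
    also have "\<dots> \<le> (\<Sum>b\<in>{..t}. \<Sum>w\<in>move_sets E t b i. prob (D w (x * real t)))"
      using fin D by (intro sum_mono finite_measure_subadditive_finite) auto
    also have "\<dots> \<le> (\<Sum>b\<in>{..t}. q t)"
      using layer t by (intro sum_mono) auto
    finally show ?thesis by (simp add: add.commute)
  qed
  have "(\<lambda>t::nat. (real t + 1) * q t) \<longlonglongrightarrow> 0"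
    unfolding q_def using \<delta> by real_asymp
  then show ?thesis
  proof (rule Lim_null_comparison[rotated])
    show "\<forall>\<^sub>F t in sequentially. norm (prob {\<omega>\<in>space M. K + x * real t < max_consensus E v x0 t i \<omega>})
        \<le> (real t + 1) * q t"
      using eventually_gt_at_top[of 0] by eventually_elim (use bound in simp)
  qed
qed

section \<open>From the tail bound to the growth rate\<close>

text \<open>If \<open>x < l\<close>, almost every trajectory eventually stays above
  \<open>K + x * t\<close>, so by dominated convergence these events have probability tending to 1,
  against the assumed limit 0.\<close>

lemma (in prob_space) AE_limit_le_if_tail_tendsto_0:
  fixes Y :: "nat \<Rightarrow> 'a \<Rightarrow> real"
  assumes meas[measurable]: "\<And>t. Y t \<in> borel_measurable M"
    and lim: "AE \<omega> in M. (\<lambda>t. Y t \<omega> / real t) \<longlonglongrightarrow> l"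
    and tail: "(\<lambda>t. prob {\<omega>\<in>space M. K + x * real t < Y t \<omega>}) \<longlonglongrightarrow> 0"
  shows "l \<le> x"
proof (rule ccontr)
  assume "\<not> l \<le> x"
  then have x: "x < l" by simp
  let ?A = "\<lambda>t. {\<omega>\<in>space M. K + x * real t < Y t \<omega>}"
  have [measurable]: "?A t \<in> events" for t by measurable
  have "(\<lambda>t. \<integral>\<omega>. indicator (?A t) \<omega> \<partial>M) \<longlonglongrightarrow> (\<integral>\<omega>. 1 \<partial>M :: real)"
  proof (rule integral_dominated_convergence[where w = "\<lambda>_. 1"])
    show "AE \<omega> in M. (\<lambda>t. indicator (?A t) \<omega>) \<longlonglongrightarrow> (1::real)"
      using lim AE_space
    proof eventually_elim
      case (elim \<omega>)
      have "(\<lambda>t. K / real t) \<longlonglongrightarrow> 0"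
        by (rule lim_const_over_n)
      from tendsto_diff[OF elim(1) this] have "(\<lambda>t. Y t \<omega> / real t - K / real t) \<longlonglongrightarrow> l" by simp
      from order_tendstoD(1)[OF this x] eventually_gt_at_top[of 0]
      have "\<forall>\<^sub>F t in sequentially. indicator (?A t) \<omega> = (1::real)"
      proof eventually_elim
        case (elim t)
        then have "K + x * real t < Y t \<omega>"
          by (simp add: field_simps)
        with \<open>\<omega> \<in> space M\<close> show ?case by simp
      qed
      then show ?case by (rule tendsto_eventually)
    qed
  qed (auto simp: indicator_def)
  then have "(\<lambda>t. prob (?A t)) \<longlonglongrightarrow> 1"
    by (simp add: prob_space)
  with tail show False
    using LIMSEQ_unique by fastforce
qed

lemma neighbors_nonempty:
  assumes "N \<ge> 2" and "connected_graph N E" and "i \<in> {1..N}"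
  shows "neighbors E i \<noteq> {}"
proof -
  obtain j where j: "j \<in> {1..N}" "j \<noteq> i"
    using assms(1,3) by (cases "i = 1") (auto intro: that[of 1] that[of 2])
  then have "(i, j) \<in> {(a, b). {a, b} \<in> E}\<^sup>*"
    using assms(2,3) by (auto simp: connected_graph_def)
  then show ?thesis
    using j(2) by (cases rule: converse_rtranclE) (auto simp: neighbors_def)
qed

theorem theorem1:
  fixes N :: nat and E :: "nat set set"
    and P :: "'a measure" and v :: "nat \<Rightarrow> nat \<Rightarrow> nat \<Rightarrow> 'a \<Rightarrow> real" and \<mu> :: "real measure"
    and x0 :: "nat \<Rightarrow> real" and l \<rho> :: real
  assumes "N \<ge> 2" and "simple_graph N E" and "connected_graph N E"
    and rho: "\<rho> = spectral_radius (adjacency_matrix N E)"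
    and "prob_space P"
    and indep: "prob_space.indep_vars P (\<lambda>_. borel) (\<lambda>(i, j, t). v i j t) {(i, j, t). {i, j} \<in> E}"
    and ident: "\<And>i j t. {i, j} \<in> E \<Longrightarrow> distr P borel (v i j t) = \<mu>"
    and mean: "integrable \<mu> (\<lambda>y. y)" "(\<integral>y. y \<partial>\<mu>) = 0"
    and mgf: "\<forall>\<^sub>F \<gamma> in nhds 0. mgf \<mu> \<gamma> < \<infinity>"
    and growth: "is_growth_rate P N E v x0 l"
  shows "ereal l \<le> (INF x\<in>{x::real. (SUP \<beta>\<in>{0..1::real}.
           ereal (entropy_fun \<beta> + \<beta> * ln \<rho>) - scaled_rate \<mu> \<beta> x) < 0}. ereal x)"
proof (rule INF_greatest)
  interpret prob_space P by fact
  note nbs = neighbors_simple_graph[OF assms(2)] and nb = neighbors_nonempty[OF assms(1,3)]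
  have meas: "v i j t \<in> borel_measurable P" if "{i, j} \<in> E" for i j t
    using indep that by (force simp: indep_vars_def)
  \<comment> \<open>The law \<open>\<mu>\<close> is tied to the samples through edges only, so one
    edge is picked to see that it is a probability measure.\<close>
  obtain j where j: "{1, j} \<in> E"
    using nb[of 1] assms(1) by (auto simp: neighbors_def)
  have "prob_space \<mu>"
    using prob_space_distr[OF meas[OF j, of 0]] ident[OF j, of 0] by simp
  then have mgf_1: "1 \<le> mgf \<mu> \<gamma>" for \<gamma>
    using mean by (rule mgf_ge_1)
  have "adjacency_matrix N E \<in> carrier_mat N N"
    by (simp add: adjacency_matrix_def)
  then have \<rho>: "\<rho> \<ge> 0"
    using spectral_radius_mem_max(1)[of "adjacency_matrix N E" N] assms(1) by (auto simp: rho)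
  fix x :: real
  let ?F = "\<lambda>\<beta>. ereal (entropy_fun \<beta> + \<beta> * ln \<rho>) - scaled_rate \<mu> \<beta> x"
  assume "x \<in> {x. (SUP \<beta>\<in>{0..1}. ereal (entropy_fun \<beta> + \<beta> * ln \<rho>) - scaled_rate \<mu> \<beta> x) < 0}"
  then have "(SUP \<beta>\<in>{0..1}. ?F \<beta>) < 0" by simp
  \<comment> \<open>The number \<open>z\<close> separates the supremum from 0, which makes
    \<open>- z\<close> a positive margin valid for all \<open>\<beta>\<close> at once.\<close>
  then obtain z where z: "(SUP \<beta>\<in>{0..1}. ?F \<beta>) < ereal z" "ereal z < 0"
    using ereal_dense2 by blast
  have F: "?F \<beta> < ereal z" if "\<beta> \<in> {0..1}" for \<beta>
    using SUP_upper[OF that, of ?F] z(1) by (rule le_less_trans)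
  have x: "x \<ge> 0"
    using less_trans[OF F z(2)] by (intro nonneg_of_rate_condition[OF mgf_1 \<rho>])
  have rate: "\<exists>\<gamma> m. \<gamma> > 0 \<and> m > 0 \<and> mgf \<mu> \<gamma> = ennreal m \<and>
      entropy_fun \<beta> + \<beta> * ln (spectral_radius (adjacency_matrix N E)) + - z < x * \<gamma> - \<beta> * ln m"
    if \<beta>: "0 < \<beta>" "\<beta> \<le> 1" for \<beta>
  proof -
    have "ereal (entropy_fun \<beta> + \<beta> * ln \<rho> + - z) < scaled_rate \<mu> \<beta> x"
      using F[of \<beta>] \<beta> by (cases "scaled_rate \<mu> \<beta> x") auto
    then show ?thesis
      unfolding rho by (rule less_scaled_rateE[OF mgf_1 \<beta>(1)]) blast
  qed
  define K where "K = Max (x0 ` {1..N})"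
  have K: "x0 i \<le> K" if "i \<in> {1..N}" for i
    using that by (simp add: K_def)
  \<comment> \<open>The rate \<open>l\<close> is common to all vertices, so one vertex
    suffices.\<close>
  have one: "1 \<in> {1..N}" using assms(1) by simp
  have "(\<lambda>t. prob {\<omega>\<in>space P. K + x * real t < max_consensus E v x0 t 1 \<omega>}) \<longlonglongrightarrow> 0"
    using z(2) K one rate
    by (intro max_consensus_tail_tendsto_0[where \<delta> = "- z", OF assms(2) nb indep ident x]) auto
  moreover have "max_consensus E v x0 t 1 \<in> borel_measurable P" for t
    using nbs nb meas one by (intro measurable_max_consensus[of E "{1..N}"]) auto
  moreover have "AE \<omega> in P. (\<lambda>t. max_consensus E v x0 t 1 \<omega> / real t) \<longlonglongrightarrow> l"
    using growth one by (auto simp: is_growth_rate_def)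
  ultimately have "l \<le> x"
    by (intro AE_limit_le_if_tail_tendsto_0)
  then show "ereal l \<le> ereal x" by simp
qed

end
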